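(* Let $X$ be a complex Banach space and let $T\in B(X)$ be an invertible operator such that $\sup_{n\in\mathbb{Z}}\|T^n\|<\infty$. Suppose that $\lambda\in\sigma(T)$ is an isolated point of $\sigma(T)$, and let $P_\lambda$ be the Riesz projection of $T$ corresponding to $\{\lambda\}$. Then $\lambda$ is an eigenvalue of $T$, the eigenspace $\{x\in X : Tx=\lambda x\}$ of $T$ corresponding to $\lambda$ is $P_\lambda(X)$, and it has the invariant complement $\ker P_\lambda$; that is, $\ker P_\lambda$ is a $T$-invariant subspace and $X=P_\lambda(X)\oplus\ker P_\lambda$.
   Context: $B(X)$ is the algebra of all bounded complex linear operators on the complex Banach space $X$, $I$ is the identity operator on $X$, and $\sigma(T)$ is the spectrum of $T\in B(X)$. A projection is an operator $P\in B(X)$ with $P^2=P$ (no self-adjointness is required). Let $T\in B(X)$ and suppose $\sigma(T)$ is the disjoint union of two closed subsets $\sigma$ and $\tau$. The Riesz projection of $T$ corresponding to $\sigma$ is $P_\sigma=\frac{1}{2\pi i}\int_\Gamma (wI-T)^{-1}\,dw$, where $\Gamma$ is a (positively oriented) Cauchy contour in the resolvent set of $T$ around $\sigma$ separating $\sigma$ from $\tau$; it is a projection and does not depend on the choice of $\Gamma$. For an isolated point $\lambda$ of $\sigma(T)$, the Riesz projection corresponding to $\lambda$ is the one with $\sigma=\{\lambda\}$ and $\tau=\sigma(T)\setminus\{\lambda\}$; thus $\Gamma$ may be taken to be a small positively oriented circle centered at $\lambda$ such that no other point of $\sigma(T)$ lies on or inside it. *)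

theory Defs
  imports "HOL-Complex_Analysis.Complex_Analysis"
begin

section \<open>Complex Banach spaces\<close>

text \<open>A complex norm on a real normed space: complex scalar multiplication extends the real one
  and the norm is absolutely homogeneous over the complex numbers.\<close>

class complex_normed_vector = real_normed_vector +
  fixes scaleC :: "complex \<Rightarrow> 'a \<Rightarrow> 'a"  (infixr \<open>*\<^sub>C\<close> 75)
  assumes scaleC_add_right: "c *\<^sub>C (x + y) = c *\<^sub>C x + c *\<^sub>C y"
    and scaleC_add_left: "(c + d) *\<^sub>C x = c *\<^sub>C x + d *\<^sub>C x"
    and scaleC_scaleC: "c *\<^sub>C (d *\<^sub>C x) = (c * d) *\<^sub>C x"
    and scaleR_scaleC: "scaleR r x = complex_of_real r *\<^sub>C x"
    and norm_scaleC: "norm (c *\<^sub>C x) = cmod c * norm x"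

class complex_banach = complex_normed_vector + banach

lemma bounded_linear_scaleC: "bounded_linear (\<lambda>x::'a::complex_normed_vector. c *\<^sub>C x)"
proof (rule bounded_linear_intro[where K = "cmod c"])
  show "c *\<^sub>C scaleR r x = scaleR r (c *\<^sub>C x)" for r and x :: 'a
    by (simp add: scaleR_scaleC scaleC_scaleC mult.commute)
qed (simp_all add: scaleC_add_right norm_scaleC mult.commute)

instantiation complex :: complex_banach
begin

definition scaleC_complex :: "complex \<Rightarrow> complex \<Rightarrow> complex"
  where "scaleC_complex c x = c * x"

instance
  by standard (simp_all add: scaleC_complex_def algebra_simps norm_mult scaleR_conv_of_real)

end

text \<open>The library's type of bounded operators has real-linear maps as its elements, which are
  cut down below by \<open>complex_linear\<close>. The codomain makes it a complex normed space under
  pointwise scalar multiplication; with respect to this structure, operator-valued contour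
  integrals converge in operator norm.\<close>

instantiation blinfun :: (real_normed_vector, complex_normed_vector) complex_normed_vector
begin

lift_definition scaleC_blinfun :: "complex \<Rightarrow> ('a \<Rightarrow>\<^sub>L 'b) \<Rightarrow> ('a \<Rightarrow>\<^sub>L 'b)"
  is "\<lambda>c A x. c *\<^sub>C A x"
  by (rule bounded_linear_compose[OF bounded_linear_scaleC])

instance
proof
  fix c d :: complex and r :: real and A B :: "'a \<Rightarrow>\<^sub>L 'b"
  show "c *\<^sub>C (A + B) = c *\<^sub>C A + c *\<^sub>C B"
    by transfer (simp add: scaleC_add_right)
  show "(c + d) *\<^sub>C A = c *\<^sub>C A + d *\<^sub>C A"
    by transfer (simp add: scaleC_add_left)
  show "c *\<^sub>C (d *\<^sub>C A) = (c * d) *\<^sub>C A"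
    by transfer (simp add: scaleC_scaleC)
  show "scaleR r A = complex_of_real r *\<^sub>C A"
    by transfer (simp add: scaleR_scaleC)
  show "norm (c *\<^sub>C A) = cmod c * norm A"
  proof transfer
    fix c :: complex and f :: "'a \<Rightarrow> 'b"
    assume f: "bounded_linear f"
    have le: "onorm (\<lambda>x. c *\<^sub>C g x) \<le> cmod c * onorm g"
      if "bounded_linear g" for c and g :: "'a \<Rightarrow> 'b"
    proof (rule onorm_bound)
      show "norm (c *\<^sub>C g x) \<le> cmod c * onorm g * norm x" for x
        using onorm[OF that, of x] by (simp add: norm_scaleC mult.assoc mult_left_mono)
    qed (simp add: onorm_pos_le[OF that])
    show "onorm (\<lambda>x. c *\<^sub>C f x) = cmod c * onorm f"
    proof (cases "c = 0")
      case True
      then show ?thesis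
        using le[OF f, of c] onorm_pos_le[OF bounded_linear_compose[OF bounded_linear_scaleC f]]
        by (simp add: order_antisym)
    next
      case False
      have one: "1 *\<^sub>C x = x" for x :: 'b
        using scaleR_scaleC[of 1 x] by simp
      have "onorm (\<lambda>x. inverse c *\<^sub>C c *\<^sub>C f x) \<le> cmod (inverse c) * onorm (\<lambda>x. c *\<^sub>C f x)"
        by (rule le[OF bounded_linear_compose[OF bounded_linear_scaleC f]])
      then have "cmod c * onorm f \<le> onorm (\<lambda>x. c *\<^sub>C f x)"
        using False by (simp add: scaleC_scaleC one norm_inverse norm_divide field_simps)
      with le[OF f, of c] show ?thesis by simp
    qed
  qed
qed

end

instance blinfun :: (real_normed_vector, complex_banach) complex_banach ..


section \<open>Operators, inverses and spectrum\<close>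

definition complex_linear :: "('a::complex_normed_vector \<Rightarrow>\<^sub>L 'a) \<Rightarrow> bool"
  where "complex_linear A \<longleftrightarrow> (\<forall>c x. A (c *\<^sub>C x) = c *\<^sub>C A x)"

definition is_inverse_op ::
    "('a::complex_normed_vector \<Rightarrow>\<^sub>L 'a) \<Rightarrow> ('a \<Rightarrow>\<^sub>L 'a) \<Rightarrow> bool"
  where "is_inverse_op A S \<longleftrightarrow>
    complex_linear S \<and> S o\<^sub>L A = id_blinfun \<and> A o\<^sub>L S = id_blinfun"

definition invertible_op :: "('a::complex_normed_vector \<Rightarrow>\<^sub>L 'a) \<Rightarrow> bool"
  where "invertible_op A \<longleftrightarrow> (\<exists>S. is_inverse_op A S)"

definition inverse_op :: "('a::complex_normed_vector \<Rightarrow>\<^sub>L 'a) \<Rightarrow> ('a \<Rightarrow>\<^sub>L 'a)"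
  where "inverse_op A = (THE S. is_inverse_op A S)"

lemma inverse_op_eq: "is_inverse_op A S \<Longrightarrow> inverse_op A = S"
  unfolding inverse_op_def
proof (rule the_equality)
  fix R assume "is_inverse_op A S" "is_inverse_op A R"
  then have S: "A (S x) = x" and R: "R (A x) = x" for x
    unfolding is_inverse_op_def
    by (metis blinfun_apply_blinfun_compose blinfun_apply_id_blinfun)+
  have "R x = S x" for x
    using R[of "S x"] by (simp add: S)
  then show "R = S"
    by (rule blinfun_eqI)
qed

primrec power_op :: "('a::real_normed_vector \<Rightarrow>\<^sub>L 'a) \<Rightarrow> nat \<Rightarrow> ('a \<Rightarrow>\<^sub>L 'a)"
  where
    "power_op A 0 = id_blinfun"
  | "power_op A (Suc n) = A o\<^sub>L power_op A n"

definition powi_op :: "('a::complex_normed_vector \<Rightarrow>\<^sub>L 'a) \<Rightarrow> int \<Rightarrow> ('a \<Rightarrow>\<^sub>L 'a)"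
  where "powi_op A n =
    (if n \<ge> 0 then power_op A (nat n) else power_op (inverse_op A) (nat (- n)))"

definition op_spectrum :: "('a::complex_normed_vector \<Rightarrow>\<^sub>L 'a) \<Rightarrow> complex set"
  where "op_spectrum T = {w. \<not> invertible_op (w *\<^sub>C id_blinfun - T)}"

definition op_resolvent :: "('a::complex_normed_vector \<Rightarrow>\<^sub>L 'a) \<Rightarrow> complex \<Rightarrow> ('a \<Rightarrow>\<^sub>L 'a)"
  where "op_resolvent T w = inverse_op (w *\<^sub>C id_blinfun - T)"

definition op_eigenspace :: "('a::complex_normed_vector \<Rightarrow>\<^sub>L 'a) \<Rightarrow> complex \<Rightarrow> 'a set"
  where "op_eigenspace T \<mu> = {x. T x = \<mu> *\<^sub>C x}"

definition op_eigenvalue :: "('a::complex_normed_vector \<Rightarrow>\<^sub>L 'a) \<Rightarrow> complex \<Rightarrow> bool"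
  where "op_eigenvalue T \<mu> \<longleftrightarrow> (\<exists>x. x \<noteq> 0 \<and> T x = \<mu> *\<^sub>C x)"

definition op_kernel :: "('a::real_normed_vector \<Rightarrow>\<^sub>L 'a) \<Rightarrow> 'a set"
  where "op_kernel A = {x. A x = 0}"


section \<open>Subspaces\<close>

definition complex_subspace :: "'a::complex_normed_vector set \<Rightarrow> bool"
  where "complex_subspace M \<longleftrightarrow> module.subspace (*\<^sub>C) M"

definition invariant_subspace ::
    "('a::complex_normed_vector \<Rightarrow>\<^sub>L 'a) \<Rightarrow> 'a set \<Rightarrow> bool"
  where "invariant_subspace T M \<longleftrightarrow> complex_subspace M \<and> (\<forall>x\<in>M. T x \<in> M)"

definition direct_sum_decomp :: "'a::complex_normed_vector set \<Rightarrow> 'a set \<Rightarrow> bool"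
  where "direct_sum_decomp M N \<longleftrightarrow>
    complex_subspace M \<and> complex_subspace N \<and> M \<inter> N = {0} \<and> (\<forall>x. \<exists>u\<in>M. \<exists>v\<in>N. x = u + v)"


section \<open>Riesz projections\<close>

text \<open>The integrand follows the library's \<open>has_contour_integral\<close>, with complex multiplication
  replaced by scalar multiplication.\<close>

definition vector_contour_integral :: "(real \<Rightarrow> complex) \<Rightarrow> (complex \<Rightarrow> 'b::complex_banach) \<Rightarrow> 'b"
  where "vector_contour_integral g f =
    integral {0..1} (\<lambda>t. vector_derivative g (at t within {0..1}) *\<^sub>C f (g t))"

definition riesz_integral ::
    "('a::complex_banach \<Rightarrow>\<^sub>L 'a) \<Rightarrow> (real \<Rightarrow> complex) \<Rightarrow> ('a \<Rightarrow>\<^sub>L 'a)"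
  where "riesz_integral T g =
    (1 / (2 * of_real pi * \<i>)) *\<^sub>C vector_contour_integral g (op_resolvent T)"

text \<open>\<open>P\<close> is the Riesz projection of \<open>T\<close> corresponding to \<open>{\<mu>}\<close>, where \<open>\<mu>\<close> is an isolated
  point of the spectrum. Any positively oriented circle about \<open>\<mu>\<close> such that no other point of
  the spectrum lies on or inside it may serve as the contour.\<close>

definition is_riesz_projection_at ::
    "('a::complex_banach \<Rightarrow>\<^sub>L 'a) \<Rightarrow> complex \<Rightarrow> ('a \<Rightarrow>\<^sub>L 'a) \<Rightarrow> bool"
  where "is_riesz_projection_at T \<mu> P \<longleftrightarrow>
    (\<exists>r>0. cball \<mu> r \<inter> op_spectrum T = {\<mu>} \<and> P = riesz_integral T (circlepath \<mu> r))"

end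

theory Submission
  imports Defs
begin

text \<open>Write \<open>u = s e\<^sup>i\<^sup>\<theta>\<close>, and let \<open>A\<^sub>k\<close> be the mean over \<open>\<theta>\<close> of \<open>u\<^sup>k R(\<mu> + u)\<close>, where \<open>R\<close> is the
  resolvent. Then \<open>P = A\<^sub>1\<close>, and averaging \<open>(T - \<mu>) R(\<mu> + u) = u R(\<mu> + u) - I\<close> gives
  \<open>(T - \<mu>) A\<^sub>0 = P - I\<close> and \<open>(T - \<mu>) P = A\<^sub>2\<close>. Since \<open>A\<^sub>0\<close> does not depend on the radius \<open>s\<close>, neither
  do \<open>A\<^sub>1\<close> and \<open>A\<^sub>2\<close>. Power-boundedness gives \<open>\<parallel>R(w)\<parallel> \<le> C / \<bar>\<bar>w\<bar> - 1\<bar>\<close>, and \<open>\<bar>\<mu>\<bar> = 1\<close>. The quadratic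
  \<open>p = u\<^sup>2 + s\<^sup>2 \<mu> u + s\<^sup>2 \<mu>\<^sup>2\<close> vanishes where the circle meets the unit circle and satisfies
  \<open>\<bar>p\<bar> = s \<bar>\<bar>w\<bar>\<^sup>2 - 1\<bar>\<close>, so \<open>A\<^sub>2 + s\<^sup>2 \<mu> A\<^sub>1 + s\<^sup>2 \<mu>\<^sup>2 A\<^sub>0 = O(s)\<close>. Letting \<open>s \<rightarrow> 0\<close> yields
  \<open>(T - \<mu>) P = 0\<close>. Conversely \<open>u R(\<mu> + u)\<close> fixes every eigenvector, hence so does \<open>P\<close>. If \<open>P\<close> were
  zero, \<open>-A\<^sub>0\<close> would invert \<open>T - \<mu>\<close>.\<close>

section \<open>Complex scalars, kernels, ranges and projections\<close>

interpretation scaleC: vector_space "(*\<^sub>C) :: complex \<Rightarrow> 'a::complex_normed_vector \<Rightarrow> 'a"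
proof
  show "1 *\<^sub>C x = x" for x :: 'a
    using scaleR_scaleC[of 1 x] by simp
qed (simp_all add: scaleC_add_right scaleC_add_left scaleC_scaleC)

text \<open>Over the reals, scalar multiplication is a bounded bilinear map; this supplies its
  continuity and the real-linear maps \<open>c \<mapsto> c *\<^sub>C x\<close> used under
  integrals.\<close>

interpretation scaleC: bounded_bilinear "(*\<^sub>C) :: complex \<Rightarrow> 'a::complex_normed_vector \<Rightarrow> 'a"
proof
  show "\<exists>K. \<forall>a b. norm (a *\<^sub>C (b::'a)) \<le> norm a * norm b * K"
    by (rule exI[of _ 1]) (simp add: norm_scaleC)
  show "(r *\<^sub>R a) *\<^sub>C b = r *\<^sub>R (a *\<^sub>C b)" "a *\<^sub>C (r *\<^sub>R b) = r *\<^sub>R (a *\<^sub>C b)" for r a and b :: 'a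
    by (simp_all only: scaleR_scaleC[where 'a='a] scaleC_scaleC scaleR_conv_of_real mult.commute)
qed (simp_all add: scaleC_add_right scaleC_add_left)

lemma blinfun_apply_scaleC [simp]: "blinfun_apply (c *\<^sub>C A) x = c *\<^sub>C blinfun_apply A x"
  by transfer simp

lemma complex_linearD: "complex_linear A \<Longrightarrow> A (c *\<^sub>C x) = c *\<^sub>C A x"
  by (simp add: complex_linear_def)

lemma is_inverse_op_iff:
  "is_inverse_op A S \<longleftrightarrow> complex_linear S \<and> (\<forall>x. S (A x) = x) \<and> (\<forall>x. A (S x) = x)"
  by (auto simp: is_inverse_op_def blinfun_apply_inject[symmetric] fun_eq_iff)

lemma is_inverse_op_inverse_op: "invertible_op A \<Longrightarrow> is_inverse_op A (inverse_op A)"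
  unfolding invertible_op_def using inverse_op_eq by blast

lemma complex_subspace_kernel: "complex_linear A \<Longrightarrow> complex_subspace (op_kernel A)"
  by (auto simp: complex_subspace_def scaleC.subspace_def op_kernel_def complex_linearD
      blinfun.add_right blinfun.zero_right)

lemma complex_subspace_range:
  assumes "complex_linear A"
  shows "complex_subspace (range (blinfun_apply A))"
proof -
  have "blinfun_apply A x + blinfun_apply A y \<in> range (blinfun_apply A)" for x y
    by (metis blinfun.add_right rangeI)
  moreover have "c *\<^sub>C blinfun_apply A x \<in> range (blinfun_apply A)" for c x
    by (metis complex_linearD[OF assms] rangeI)
  moreover have "0 \<in> range (blinfun_apply A)"
    by (metis blinfun.zero_right rangeI)
  ultimately show ?thesis
    by (auto simp: complex_subspace_def scaleC.subspace_def)
qed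

lemma direct_sum_decomp_projection:
  assumes "complex_linear P" and idem: "\<And>x. P (P x) = P x"
  shows "direct_sum_decomp (range (blinfun_apply P)) (op_kernel P)"
  unfolding direct_sum_decomp_def
proof (intro conjI allI)
  show "range (blinfun_apply P) \<inter> op_kernel P = {0}"
  proof
    show "range (blinfun_apply P) \<inter> op_kernel P \<subseteq> {0}"
      using idem by (auto simp: op_kernel_def)
    have "0 = P 0" by (simp add: blinfun.zero_right)
    then show "{0} \<subseteq> range (blinfun_apply P) \<inter> op_kernel P"
      unfolding op_kernel_def by (metis (mono_tags) IntI empty_subsetI insert_subset mem_Collect_eq rangeI)
  qed
  fix x
  have "x - P x \<in> op_kernel P"
    using idem by (simp add: op_kernel_def blinfun.diff_right)
  then show "\<exists>u\<in>range (blinfun_apply P). \<exists>v\<in>op_kernel P. x = u + v"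
    by (metis add_diff_cancel_left' diff_add_cancel add.commute rangeI)
qed (use assms complex_subspace_kernel complex_subspace_range in auto)


section \<open>The resolvent\<close>

lemma is_inverse_op_resolvent:
  "w \<notin> op_spectrum T \<Longrightarrow> is_inverse_op (w *\<^sub>C id_blinfun - T) (op_resolvent T w)"
  by (simp add: op_spectrum_def op_resolvent_def is_inverse_op_inverse_op)

lemma
  assumes "w \<notin> op_spectrum T"
  shows complex_linear_resolvent: "complex_linear (op_resolvent T w)"
    and resolvent_left: "op_resolvent T w (w *\<^sub>C x - T x) = x"
    and resolvent_right: "w *\<^sub>C op_resolvent T w x - T (op_resolvent T w x) = x"
  using is_inverse_op_resolvent[OF assms]
  by (simp_all add: is_inverse_op_iff blinfun.diff_left)

lemma resolvent_commute:
  assumes "w \<notin> op_spectrum T"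
  shows "op_resolvent T w (T x) = T (op_resolvent T w x)"
proof -
  have "op_resolvent T w (T x) = w *\<^sub>C op_resolvent T w x - op_resolvent T w (w *\<^sub>C x - T x)"
    by (simp add: blinfun.diff_right complex_linearD[OF complex_linear_resolvent[OF assms]])
  also have "\<dots> = w *\<^sub>C op_resolvent T w x - x"
    by (simp only: resolvent_left[OF assms])
  also have "\<dots> = T (op_resolvent T w x)"
    using resolvent_right[OF assms, of x] by (simp add: algebra_simps)
  finally show ?thesis .
qed

text \<open>With \<open>y = R(v) x\<close>, apply \<open>R(w)\<close> to
  \<open>x = v y - T y = (v - w) y + (w y - T y)\<close>.\<close>

lemma resolvent_identity:
  assumes "w \<notin> op_spectrum T" "v \<notin> op_spectrum T"
  shows "op_resolvent T w - op_resolvent T v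
    = (v - w) *\<^sub>C (op_resolvent T w o\<^sub>L op_resolvent T v)"
proof (rule blinfun_eqI)
  fix x
  let ?R = "op_resolvent T"
  define y where "y = ?R v x"
  have "?R w x = ?R w (v *\<^sub>C y - T y)"
    using resolvent_right[OF assms(2), of x] by (simp add: y_def)
  also have "v *\<^sub>C y - T y = (v - w) *\<^sub>C y + (w *\<^sub>C y - T y)"
    by (simp add: scaleC.scale_left_diff_distrib)
  also have "?R w \<dots> = (v - w) *\<^sub>C ?R w y + y"
    by (simp only: blinfun.add_right resolvent_left[OF assms(1)]
        complex_linearD[OF complex_linear_resolvent[OF assms(1)]])
  finally show "blinfun_apply (?R w - ?R v) x = blinfun_apply ((v - w) *\<^sub>C (?R w o\<^sub>L ?R v)) x"
    by (simp add: blinfun.diff_left y_def)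
qed

text \<open>The resolvent identity first bounds \<open>R(v)\<close> for \<open>v\<close> near
  \<open>w\<close>, and then makes \<open>R(v) - R(w)\<close> of order \<open>v - w\<close>.\<close>

lemma continuous_on_resolvent: "continuous_on (- op_spectrum T) (op_resolvent T)"
proof (clarsimp simp: continuous_on_def)
  fix w assume w: "w \<notin> op_spectrum T"
  let ?R = "op_resolvent T"
  define K where "K = norm (?R w) + 1"
  have K: "K > 0" "norm (?R w) \<le> K" by (simp_all add: K_def add_nonneg_pos)
  have diff: "norm (?R v - ?R w) \<le> cmod (v - w) * K * norm (?R v)" if "v \<notin> op_spectrum T" for v
  proof -
    have "norm (?R w - ?R v) \<le> cmod (v - w) * (norm (?R w) * norm (?R v))"
      unfolding resolvent_identity[OF w that] norm_scaleC
      by (intro mult_left_mono norm_blinfun_compose) auto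
    also have "\<dots> \<le> cmod (v - w) * (K * norm (?R v))"
      using K by (intro mult_left_mono mult_right_mono) auto
    finally show ?thesis by (simp add: norm_minus_commute mult.assoc)
  qed
  \<comment> \<open>Where \<open>\<bar>v - w\<bar> K \<le> 1/2\<close>, half of
    \<open>\<parallel>R(v)\<parallel>\<close> is absorbed into the left-hand side.\<close>
  have bound: "norm (?R v) \<le> 2 * K" if "v \<notin> op_spectrum T" "cmod (v - w) * K \<le> 1 / 2" for v
  proof -
    have "norm (?R v) \<le> norm (?R w) + norm (?R v - ?R w)"
      by (metis norm_triangle_sub)
    also have "\<dots> \<le> K + 1 / 2 * norm (?R v)"
      using diff[OF that(1)] mult_right_mono[OF that(2), of "norm (?R v)"] K(2) by simp
    finally show ?thesis by simp
  qed
  show "(?R \<longlongrightarrow> ?R w) (at w within - op_spectrum T)"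
  proof (rule metric_tendsto_imp_tendsto)
    show "((\<lambda>v. cmod (v - w) * K * (2 * K)) \<longlongrightarrow> 0) (at w within - op_spectrum T)"
      by (auto intro!: tendsto_eq_intros)
    have "((\<lambda>v. cmod (v - w) * K) \<longlongrightarrow> 0) (at w within - op_spectrum T)"
      by (auto intro!: tendsto_eq_intros)
    then have "\<forall>\<^sub>F v in at w within - op_spectrum T. cmod (v - w) * K < 1 / 2"
      by (rule order_tendstoD) simp
    moreover have "\<forall>\<^sub>F v in at w within - op_spectrum T. v \<notin> op_spectrum T"
      by (simp add: eventually_at_topological) blast
    ultimately show "\<forall>\<^sub>F v in at w within - op_spectrum T.
        dist (?R v) (?R w) \<le> dist (cmod (v - w) * K * (2 * K)) 0"
    proof eventually_elim
      case (elim v)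
      have "cmod (v - w) * K * norm (?R v) \<le> cmod (v - w) * K * (2 * K)"
        using bound[OF elim(2)] elim(1) K(1) by (intro mult_left_mono) auto
      then show ?case
        using diff[OF elim(2)] K(1) by (simp add: dist_norm)
    qed
  qed
qed

text \<open>By the resolvent identity the remainder is exactly
  \<open>(v - w) R(w) (R(w) - R(v))\<close>, and the last factor tends to 0 by continuity.\<close>

lemma has_derivative_resolvent:
  assumes w: "w \<notin> op_spectrum T"
  shows "(op_resolvent T has_derivative
      (\<lambda>h. - (h *\<^sub>C (op_resolvent T w o\<^sub>L op_resolvent T w)))) (at w within - op_spectrum T)"
proof (rule has_derivativeI)
  let ?R = "op_resolvent T"
  show "bounded_linear (\<lambda>h. - (h *\<^sub>C (?R w o\<^sub>L ?R w)))"
    by (intro bounded_linear_minus scaleC.bounded_linear_left)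
  have lim: "((\<lambda>v. norm (?R w) * norm (?R w - ?R v)) \<longlongrightarrow> 0) (at w within - op_spectrum T)"
    using continuous_on_resolvent[of T] w
    by (auto simp: continuous_on_def intro!: tendsto_eq_intros)
  show "((\<lambda>v. (?R v - ?R w - - ((v - w) *\<^sub>C (?R w o\<^sub>L ?R w))) /\<^sub>R norm (v - w))
      \<longlongrightarrow> 0) (at w within - op_spectrum T)"
  proof (rule Lim_null_comparison[OF _ lim])
    have "\<forall>\<^sub>F v in at w within - op_spectrum T. v \<notin> op_spectrum T \<and> v \<noteq> w"
      by (simp add: eventually_at_topological) blast
    then show "\<forall>\<^sub>F v in at w within - op_spectrum T.
        norm ((?R v - ?R w - - ((v - w) *\<^sub>C (?R w o\<^sub>L ?R w))) /\<^sub>R norm (v - w))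
        \<le> norm (?R w) * norm (?R w - ?R v)"
    proof eventually_elim
      case (elim v)
      have "?R v - ?R w - - ((v - w) *\<^sub>C (?R w o\<^sub>L ?R w))
          = (v - w) *\<^sub>C (?R w o\<^sub>L (?R w - ?R v))"
        using resolvent_identity[OF w, of v] elim
        by (simp add: algebra_simps bounded_bilinear.diff_right[OF bounded_bilinear_blinfun_compose] scaleC.diff_right)
      then show ?case
        using norm_blinfun_compose[of "?R w" "?R w - ?R v"] elim
        by (simp add: norm_scaleC flip: mult.assoc)
    qed
  qed
qed


section \<open>Resolvent growth of doubly power-bounded operators\<close>

lemma complex_linear_power_op: "complex_linear A \<Longrightarrow> complex_linear (power_op A n)"
  by (induction n) (auto simp: complex_linear_def)

lemma power_op_Suc_right: "power_op A (Suc n) x = power_op A n (A x)"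
  by (induction n) auto

text \<open>The equivalent norm \<open>sup n. \<parallel>A\<^sup>n y\<parallel>\<close> makes \<open>A\<close> a contraction.\<close>

lemma power_bounded_fixed_point_bound:
  fixes A :: "'a::complex_normed_vector \<Rightarrow>\<^sub>L 'a"
  assumes A: "complex_linear A" and M: "\<And>n. norm (power_op A n) \<le> M"
    and y: "y = z *\<^sub>C A y + v"
  shows "(1 - cmod z) * norm y \<le> M * norm v"
proof (cases "cmod z \<le> 1")
  case False
  have "0 \<le> M" using M[of 0] norm_ge_zero order_trans by blast
  then show ?thesis
    using False by (smt (verit) mult_nonneg_nonneg mult_nonpos_nonneg norm_ge_zero)
next
  case True
  define c where "c = (SUP n. norm (power_op A n y))"
  have Mx: "norm (power_op A n x) \<le> M * norm x" for n x
    using norm_blinfun[of "power_op A n" x] mult_right_mono[OF M[of n], of "norm x"] by simp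
  have bdd: "bdd_above (range (\<lambda>n. norm (power_op A n y)))"
    by (rule bdd_aboveI2) (rule Mx)
  have le_c: "norm (power_op A n y) \<le> c" for n
    unfolding c_def by (rule cSUP_upper[OF _ bdd]) simp
  \<comment> \<open>Apply \<open>A^n\<close> to the equation for \<open>y\<close> and take the
    supremum: \<open>A^(n+1) y\<close> is again bounded by \<open>c\<close>.\<close>
  have "c \<le> cmod z * c + M * norm v"
    unfolding c_def
  proof (rule cSUP_least, simp, fold c_def)
    fix n
    have "power_op A n y = power_op A n (z *\<^sub>C A y + v)"
      using y by simp
    also have "\<dots> = z *\<^sub>C power_op A (Suc n) y + power_op A n v"
      by (simp only: blinfun.add_right power_op_Suc_right
          complex_linearD[OF complex_linear_power_op[OF A]])
    finally have "norm (power_op A n y)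
        \<le> cmod z * norm (power_op A (Suc n) y) + norm (power_op A n v)"
      by (metis norm_triangle_ineq norm_scaleC)
    then show "norm (power_op A n y) \<le> cmod z * c + M * norm v"
      using mult_left_mono[OF le_c[of "Suc n"], of "cmod z"] Mx[of n v] by simp
  qed
  moreover have "(1 - cmod z) * norm y \<le> (1 - cmod z) * c"
    using le_c[of 0] True by (intro mult_left_mono) auto
  ultimately show ?thesis by (simp add: algebra_simps)
qed

text \<open>Solve \<open>w y - T y = x\<close> for \<open>y\<close>: outside the unit circle divide
  by \<open>w\<close>, elsewhere apply \<open>S\<close>. Each form is a fixed-point equation with a
  contracting factor, and the two constants \<open>M\<close> and \<open>M * M\<close> are added to
  cover both cases.\<close>

lemma resolvent_growth:
  fixes T :: "'a::complex_normed_vector \<Rightarrow>\<^sub>L 'a"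
  assumes T: "complex_linear T" and S: "is_inverse_op T S"
    and MT: "\<And>n. norm (power_op T n) \<le> M" and MS: "\<And>n. norm (power_op S n) \<le> M"
    and w: "w \<notin> op_spectrum T"
  shows "\<bar>cmod w - 1\<bar> * norm (op_resolvent T w) \<le> M + M * M"
proof -
  have M0: "0 \<le> M" using MT[of 0] norm_ge_zero order_trans by blast
  have *: "\<bar>cmod w - 1\<bar> * norm (op_resolvent T w x) \<le> (M + M * M) * norm x" for x
  proof -
    define y where "y = op_resolvent T w x"
    have x: "w *\<^sub>C y - T y = x" using resolvent_right[OF w] by (simp add: y_def)
    show ?thesis
    proof (cases "cmod w > 1")
      case True
      then have w0: "w \<noteq> 0" by auto
      have "inverse w *\<^sub>C (T y + x) = inverse w *\<^sub>C w *\<^sub>C y" by (simp flip: x)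
      then have "y = inverse w *\<^sub>C T y + inverse w *\<^sub>C x"
        using w0 by (simp add: scaleC.scale_right_distrib)
      from power_bounded_fixed_point_bound[OF T MT this]
      have "cmod w * ((1 - cmod (inverse w)) * norm y) \<le> cmod w * (M * norm (inverse w *\<^sub>C x))"
        by (rule mult_left_mono) simp
      moreover have "cmod w * cmod (inverse w) = 1"
        using w0 by (simp flip: norm_mult)
      ultimately have "(cmod w - 1) * norm y \<le> M * norm x"
        by (simp add: norm_scaleC right_diff_distrib left_diff_distrib mult.left_commute[of "cmod w" M])
          (simp add: mult.assoc[symmetric])
      moreover have "0 \<le> M * M * norm x" by simp
      ultimately show ?thesis using True by (simp add: y_def algebra_simps)
    next
      case False
      have SL: "complex_linear S" and ST: "S (T y) = y" using S by (auto simp: is_inverse_op_iff)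
      \<comment> \<open>The right-hand side \<open>- S x\<close> of the resulting equation costs a
        second factor \<open>M\<close>.\<close>
      have "S x = w *\<^sub>C S y - y"
        by (simp add: ST blinfun.diff_right complex_linearD[OF SL] flip: x)
      then have "y = w *\<^sub>C S y + (- S x)" by simp
      from power_bounded_fixed_point_bound[OF SL MS this]
      have "(1 - cmod w) * norm y \<le> M * norm (S x)" by simp
      also have "\<dots> \<le> M * (M * norm x)"
      proof (rule mult_left_mono[OF _ M0])
        have "power_op S 1 = S"
          by (rule blinfun_eqI) simp
        then have "norm S \<le> M" using MS[of 1] by simp
        then show "norm (S x) \<le> M * norm x"
          by (rule order_trans[OF norm_blinfun mult_right_mono]) simp
      qed
      finally have "(1 - cmod w) * norm y \<le> M * M * norm x" by simp
      moreover have "0 \<le> M * norm x" using M0 by simp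
      ultimately show ?thesis using False by (simp add: y_def algebra_simps)
    qed
  qed
  show ?thesis
  proof (cases "cmod w = 1")
    case True
    then show ?thesis using M0 by simp
  next
    case False
    then have pos: "\<bar>cmod w - 1\<bar> > 0" by simp
    have "norm (op_resolvent T w) \<le> (M + M * M) / \<bar>cmod w - 1\<bar>"
    proof (rule norm_blinfun_bound)
      show "norm (op_resolvent T w x) \<le> (M + M * M) / \<bar>cmod w - 1\<bar> * norm x" for x
        using *[of x] pos by (simp add: field_simps)
    qed (use M0 in simp)
    then show ?thesis using pos by (simp add: field_simps)
  qed
qed


section \<open>Moments of the resolvent on circles around an isolated point\<close>

text \<open>One full turn takes unit time, so integrals over \<open>{0..1}\<close> are means over
  the circle and the parametrization agrees with \<open>circlepath\<close>.\<close>

definition unit_circle :: "real \<Rightarrow> complex"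
  where "unit_circle t = exp (2 * of_real pi * \<i> * of_real t)"

lemma norm_unit_circle [simp]: "cmod (unit_circle t) = 1"
  by (simp add: unit_circle_def)

lemma unit_circle_nonzero [simp]: "unit_circle t \<noteq> 0"
  by (simp add: unit_circle_def)

lemma unit_circle_0_1 [simp]: "unit_circle 0 = 1" "unit_circle 1 = 1"
  by (simp_all add: unit_circle_def)

lemma continuous_on_unit_circle [continuous_intros]:
  "continuous_on A f \<Longrightarrow> continuous_on A (\<lambda>t. unit_circle (f t))"
  unfolding unit_circle_def by (intro continuous_intros)

lemma has_vector_derivative_unit_circle:
  "(unit_circle has_vector_derivative 2 * of_real pi * \<i> * unit_circle t) (at t within A)"
proof -
  have "((\<lambda>z. exp (2 * of_real pi * \<i> * z)) has_field_derivative 2 * of_real pi * \<i> * unit_circle t)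
      (at (of_real t))"
    unfolding unit_circle_def by (auto intro!: derivative_eq_intros)
  then have "(((\<lambda>z. exp (2 * of_real pi * \<i> * z)) \<circ> of_real) has_vector_derivative
      1 * (2 * of_real pi * \<i> * unit_circle t)) (at t within A)"
    by (intro field_vector_diff_chain_within[where f = of_real])
      (auto intro!: derivative_eq_intros has_field_derivative_at_within
        simp: has_vector_derivative_def scaleR_conv_of_real)
  then show ?thesis by (simp add: o_def unit_circle_def[abs_def])
qed

lemma has_integral_unit_circle: "(unit_circle has_integral 0) {0..1}"
proof -
  have "((\<lambda>t. 2 * of_real pi * \<i> * unit_circle t) has_integral unit_circle 1 - unit_circle 0) {0..1}"
    by (rule fundamental_theorem_of_calculus) (auto intro: has_vector_derivative_unit_circle)
  from has_integral_mult_right[OF this, of "1 / (2 * of_real pi * \<i>)"] show ?thesis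
    by simp
qed

text \<open>The quadratic equals \<mu> u times the real number
  \<open>\<bar>\<mu> + u\<bar>^2 - 1\<close>. Its factor \<open>\<bar>\<mu> + u\<bar> - 1\<close>
  cancels the growth of the resolvent at the unit circle.\<close>

lemma norm_quadratic_circle:
  assumes "cmod \<mu> = 1" and "cmod u = s"
  shows "cmod (u\<^sup>2 + of_real (s\<^sup>2) * \<mu> * u + of_real (s\<^sup>2) * \<mu>\<^sup>2)
    = s * (\<bar>cmod (\<mu> + u) - 1\<bar> * (cmod (\<mu> + u) + 1))"
proof -
  have \<mu>: "\<mu> * cnj \<mu> = 1" and u: "u * cnj u = of_real (s\<^sup>2)"
    using assms by (simp_all flip: complex_norm_square)
  have "complex_of_real ((cmod (\<mu> + u))\<^sup>2 - 1) = \<mu> * cnj \<mu> + cnj \<mu> * u + \<mu> * cnj u + u * cnj u - 1"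
    by (simp only: of_real_diff complex_norm_square) (simp add: algebra_simps)
  then have w: "complex_of_real ((cmod (\<mu> + u))\<^sup>2 - 1) = cnj \<mu> * u + \<mu> * cnj u + of_real (s\<^sup>2)"
    by (simp add: \<mu> u)
  \<comment> \<open>Write 1 as \<open>\<mu> * cnj \<mu>\<close> and one \<open>s^2\<close> as
    \<open>u * cnj u\<close> to make the common factor visible.\<close>
  have "u\<^sup>2 + of_real (s\<^sup>2) * \<mu> * u + of_real (s\<^sup>2) * \<mu>\<^sup>2
      = (\<mu> * cnj \<mu>) * u\<^sup>2 + of_real (s\<^sup>2) * \<mu> * u + (u * cnj u) * \<mu>\<^sup>2"
    by (simp only: \<mu> u mult_1)
  also have "\<dots> = \<mu> * u * complex_of_real ((cmod (\<mu> + u))\<^sup>2 - 1)"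
    unfolding w by (simp add: algebra_simps power2_eq_square)
  finally have "cmod (u\<^sup>2 + of_real (s\<^sup>2) * \<mu> * u + of_real (s\<^sup>2) * \<mu>\<^sup>2)
      = s * \<bar>(cmod (\<mu> + u))\<^sup>2 - 1\<bar>"
    by (simp only: norm_mult norm_of_real assms mult_1)
  moreover have "(cmod (\<mu> + u))\<^sup>2 - 1 = (cmod (\<mu> + u) - 1) * (cmod (\<mu> + u) + 1)"
    by (simp add: algebra_simps power2_eq_square)
  ultimately show ?thesis by (simp add: abs_mult)
qed

text \<open>Since \<open>dw = 2 \<pi> i u dt\<close> on the circle, this is the contour integral of
  \<open>(w - \<mu>)^(k-1) R(w)\<close> divided by \<open>2 \<pi> i\<close>, the Laurent coefficient
  of \<open>(w - \<mu>)^(-k)\<close>.\<close>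

definition resolvent_moment ::
    "('a::complex_banach \<Rightarrow>\<^sub>L 'a) \<Rightarrow> complex \<Rightarrow> nat \<Rightarrow> real \<Rightarrow> ('a \<Rightarrow>\<^sub>L 'a)"
  where "resolvent_moment T \<mu> k s = integral {0..1}
    (\<lambda>t. (of_real s * unit_circle t) ^ k *\<^sub>C op_resolvent T (\<mu> + of_real s * unit_circle t))"

text \<open>The radius \<open>r\<close> is fixed as that of an admissible contour; every circle of
  radius \<open>s\<close> with \<open>0 < s \<le> r\<close> then lies in the resolvent set.\<close>

locale isolated_spectral_point =
  fixes T :: "'a::complex_banach \<Rightarrow>\<^sub>L 'a" and \<mu> :: complex and r :: real
  assumes complex_linear_T: "complex_linear T"
    and r_pos: "0 < r"
    and isolated: "cball \<mu> r \<inter> op_spectrum T = {\<mu>}"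
begin

abbreviation "u s t \<equiv> complex_of_real s * unit_circle t"
abbreviation "R \<equiv> op_resolvent T"
abbreviation "moment \<equiv> resolvent_moment T \<mu>"

lemma circle_resolvent_set: "0 < s \<Longrightarrow> s \<le> r \<Longrightarrow> \<mu> + u s t \<notin> op_spectrum T"
proof
  assume s: "0 < s" "s \<le> r" and "\<mu> + u s t \<in> op_spectrum T"
  moreover have "\<mu> + u s t \<in> cball \<mu> r"
    using s by (simp add: dist_norm norm_mult)
  ultimately have "\<mu> + u s t \<in> {\<mu>}" using isolated by blast
  then show False using s by simp
qed

lemma continuous_on_integrand:
  assumes "0 < s" "s \<le> r"
  shows "continuous_on A (\<lambda>t. u s t ^ k *\<^sub>C R (\<mu> + u s t))"
  by (intro scaleC.continuous_on continuous_intros continuous_on_compose2[OF continuous_on_resolvent])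
    (use circle_resolvent_set assms in auto)

lemma has_integral_moment:
  assumes "0 < s" "s \<le> r"
  shows "((\<lambda>t. u s t ^ k *\<^sub>C R (\<mu> + u s t)) has_integral moment k s) {0..1}"
  unfolding resolvent_moment_def
  by (rule integrable_integral, rule integrable_continuous_real, rule continuous_on_integrand[OF assms])

lemma has_integral_moment_apply:
  assumes "0 < s" "s \<le> r"
  shows "((\<lambda>t. u s t ^ k *\<^sub>C R (\<mu> + u s t) x) has_integral moment k s x) {0..1}"
  using has_integral_linear[OF has_integral_moment[OF assms, of k] blinfun.bounded_linear_left[of x]]
  by (simp add: o_def)

text \<open>The velocity of the circle is \<open>2 \<pi> i u\<close>: the constant cancels the
  normalization, and \<open>u\<close> raises the moment index to 1.\<close>

lemma riesz_integral_circlepath: "riesz_integral T (circlepath \<mu> r) = moment 1 r"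
proof -
  have r: "0 < r" "r \<le> r" using r_pos by auto
  have "vector_contour_integral (circlepath \<mu> r) R
      = integral {0..1} (\<lambda>t. (2 * of_real pi * \<i>) *\<^sub>C u r t ^ 1 *\<^sub>C R (\<mu> + u r t))"
    unfolding vector_contour_integral_def
  proof (rule integral_cong)
    fix t :: real assume "t \<in> {0..1}"
    moreover have c: "circlepath \<mu> r t = \<mu> + u r t"
      by (simp add: circlepath unit_circle_def)
    ultimately show "vector_derivative (circlepath \<mu> r) (at t within {0..1}) *\<^sub>C R (circlepath \<mu> r t)
        = (2 * of_real pi * \<i>) *\<^sub>C u r t ^ 1 *\<^sub>C R (\<mu> + u r t)"
      unfolding c by (simp add: vector_derivative_circlepath01 unit_circle_def mult_ac)
  qed
  also have "\<dots> = (2 * of_real pi * \<i>) *\<^sub>C moment 1 r"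
    using has_integral_linear[OF has_integral_moment[OF r] bounded_linear_scaleC]
    by (intro integral_unique) (simp only: o_def)
  finally show ?thesis
    by (simp add: riesz_integral_def)
qed

text \<open>The integral is formed among real-linear operators, so complex linearity is recovered by
  evaluating at a vector, where each resolvent is complex linear.\<close>

lemma complex_linear_moment:
  assumes s: "0 < s" "s \<le> r"
  shows "complex_linear (moment k s)"
  unfolding complex_linear_def
proof (intro allI)
  fix c x
  have "((\<lambda>t. c *\<^sub>C (u s t ^ k *\<^sub>C R (\<mu> + u s t) x)) has_integral c *\<^sub>C moment k s x) {0..1}"
    by (rule has_integral_linear[OF has_integral_moment_apply[OF s] bounded_linear_scaleC, unfolded o_def])
  also have "(\<lambda>t. c *\<^sub>C (u s t ^ k *\<^sub>C R (\<mu> + u s t) x)) = (\<lambda>t. u s t ^ k *\<^sub>C R (\<mu> + u s t) (c *\<^sub>C x))"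
    using s by (simp add: complex_linearD complex_linear_resolvent circle_resolvent_set
        scaleC_scaleC mult.commute)
  finally show "moment k s (c *\<^sub>C x) = c *\<^sub>C moment k s x"
    by (rule has_integral_unique[OF has_integral_moment_apply[OF s]])
qed

lemma moment_commute:
  assumes s: "0 < s" "s \<le> r"
  shows "moment k s (T x) = T (moment k s x)"
proof -
  have "((\<lambda>t. T (u s t ^ k *\<^sub>C R (\<mu> + u s t) x)) has_integral T (moment k s x)) {0..1}"
    by (rule has_integral_linear[OF has_integral_moment_apply[OF s] blinfun.bounded_linear_right, unfolded o_def])
  also have "(\<lambda>t. T (u s t ^ k *\<^sub>C R (\<mu> + u s t) x)) = (\<lambda>t. u s t ^ k *\<^sub>C R (\<mu> + u s t) (T x))"
    using s by (simp add: complex_linearD complex_linear_T resolvent_commute circle_resolvent_set)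
  finally show ?thesis
    by (rule has_integral_unique[OF has_integral_moment_apply[OF s]])
qed

text \<open>Average \<open>u^(k+1) R - (T - \<mu>) u^k R = u^k\<close>, applied to \<open>x\<close>.
  The mean of \<open>u^k\<close> is left open here: it is 1 for \<open>k = 0\<close> and 0 for
  \<open>k = 1\<close>.\<close>

lemma has_integral_moment_Suc:
  assumes s: "0 < s" "s \<le> r"
  shows "((\<lambda>t. u s t ^ k *\<^sub>C x) has_integral
    moment (Suc k) s x - (T (moment k s x) - \<mu> *\<^sub>C moment k s x)) {0..1}"
proof -
  have "((\<lambda>t. u s t ^ Suc k *\<^sub>C R (\<mu> + u s t) x - (T (u s t ^ k *\<^sub>C R (\<mu> + u s t) x)
      - \<mu> *\<^sub>C u s t ^ k *\<^sub>C R (\<mu> + u s t) x)) has_integral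
      moment (Suc k) s x - (T (moment k s x) - \<mu> *\<^sub>C moment k s x)) {0..1}"
    by (intro has_integral_diff has_integral_moment_apply[OF s]
        has_integral_linear[OF has_integral_moment_apply[OF s] blinfun.bounded_linear_right, unfolded o_def]
        has_integral_linear[OF has_integral_moment_apply[OF s] bounded_linear_scaleC, unfolded o_def])
  moreover have "u s t ^ Suc k *\<^sub>C R (\<mu> + u s t) x - (T (u s t ^ k *\<^sub>C R (\<mu> + u s t) x)
      - \<mu> *\<^sub>C u s t ^ k *\<^sub>C R (\<mu> + u s t) x) = u s t ^ k *\<^sub>C x" for t
  proof -
    define y where "y = R (\<mu> + u s t) x"
    have "u s t ^ k *\<^sub>C x = u s t ^ k *\<^sub>C ((\<mu> + u s t) *\<^sub>C y - T y)"
      unfolding y_def by (simp only: resolvent_right[OF circle_resolvent_set[OF s]])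
    then show ?thesis
      unfolding y_def[symmetric] complex_linearD[OF complex_linear_T] scaleC.scale_right_diff_distrib
        scaleC_add_left scaleC_add_right scaleC_scaleC power_Suc
      by (simp add: mult.commute)
  qed
  ultimately show ?thesis by simp
qed

lemma moment_1:
  assumes s: "0 < s" "s \<le> r"
  shows "moment 1 s x = x + (T (moment 0 s x) - \<mu> *\<^sub>C moment 0 s x)"
proof -
  have "((\<lambda>t::real. x) has_integral x) {0..1}"
    using has_integral_const_real[of x 0 1] by simp
  then show ?thesis
    using has_integral_unique[OF has_integral_moment_Suc[OF s, of 0 x]]
    by (simp add: algebra_simps)
qed

lemma moment_2:
  assumes s: "0 < s" "s \<le> r"
  shows "moment 2 s x = T (moment 1 s x) - \<mu> *\<^sub>C moment 1 s x"
proof -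
  have "((\<lambda>t. (u s t) *\<^sub>C x) has_integral (of_real s * 0) *\<^sub>C x) {0..1}"
    using has_integral_linear[OF has_integral_mult_right[OF has_integral_unit_circle]
        scaleC.bounded_linear_left]
    by (simp only: o_def)
  then have "((\<lambda>t. (u s t) ^ 1 *\<^sub>C x) has_integral 0) {0..1}"
    by simp
  from has_integral_unique[OF has_integral_moment_Suc[OF s, of 1 x] this] show ?thesis
    by (simp add: numeral_2_eq_2)
qed

lemma moment_fixed:
  assumes s: "0 < s" "s \<le> r" and x: "T x = \<mu> *\<^sub>C x"
  shows "moment 1 s x = x"
proof -
  have "u s t *\<^sub>C R (\<mu> + u s t) x = x" for t
  proof -
    have "x = R (\<mu> + u s t) ((\<mu> + u s t) *\<^sub>C x - T x)"
      by (simp only: resolvent_left[OF circle_resolvent_set[OF s]])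
    also have "\<dots> = u s t *\<^sub>C R (\<mu> + u s t) x"
      by (simp add: x scaleC_add_left complex_linearD[OF complex_linear_resolvent[OF circle_resolvent_set[OF s]]])
    finally show ?thesis by simp
  qed
  then show ?thesis
    using has_integral_unique[OF has_integral_moment_apply[OF s, of 1 x]] has_integral_const_real[of x 0 1]
    by simp
qed

text \<open>Differentiating under the integral sign in the radius gives the integrand's derivative in the
  angle, up to a constant factor, and that integrates to zero over a full turn.\<close>

lemma moment_0_const:
  assumes s: "0 < s" "s \<le> r"
  shows "moment 0 s = moment 0 r"
proof -
  let ?Q = "\<lambda>w. R w o\<^sub>L R w"
  \<comment> \<open>Used twice: along a ray, with \<open>A = {0<..r}\<close>, and along a circle,
    with \<open>A = {0..1}\<close>.\<close>
  have chain: "((\<lambda>x. R (g x)) has_vector_derivative - (g' *\<^sub>C ?Q (g x))) (at x within A)"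
    if "(g has_vector_derivative g') (at x within A)" "g ` A \<subseteq> - op_spectrum T" "x \<in> A" for g g' x A
  proof -
    have "((\<lambda>x. R (g x)) has_derivative (\<lambda>y. - ((y *\<^sub>R g') *\<^sub>C ?Q (g x)))) (at x within A)"
    proof (rule has_derivative_in_compose2[where g' = "\<lambda>w h. - (h *\<^sub>C ?Q w)"])
      show "(R has_derivative (\<lambda>h. - (h *\<^sub>C ?Q w))) (at w within - op_spectrum T)"
        if "w \<in> - op_spectrum T" for w
        using has_derivative_resolvent that by auto
    qed (use that in \<open>auto simp: has_vector_derivative_def\<close>)
    then show ?thesis
      by (simp add: has_vector_derivative_def scaleC.scaleR_left)
  qed
  have deriv: "(moment 0 has_vector_derivative 0) (at q within {0<..r})" if q: "q \<in> {0<..r}" for q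
  proof -
    have "((\<lambda>x. integral (cbox 0 1) (\<lambda>t. R (\<mu> + u x t))) has_vector_derivative
        integral (cbox 0 1) (\<lambda>t. - (unit_circle t *\<^sub>C ?Q (\<mu> + u q t)))) (at q within {0<..r})"
    proof (rule leibniz_rule_vector_derivative[OF _ _ _ q])
      fix x t :: real assume x: "x \<in> {0<..r}"
      show "((\<lambda>x. R (\<mu> + u x t)) has_vector_derivative - (unit_circle t *\<^sub>C ?Q (\<mu> + u x t)))
          (at x within {0<..r})"
        by (rule chain)
          (use x circle_resolvent_set in \<open>auto simp: has_vector_derivative_def scaleR_conv_of_real
            intro!: derivative_eq_intros\<close>)
      show "(\<lambda>t. R (\<mu> + u x t)) integrable_on cbox 0 1"
        using has_integral_moment[of x 0] x by (auto simp: integrable_on_def)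
    next
      show "continuous_on ({0<..r} \<times> cbox 0 1) (\<lambda>(x, t). - (unit_circle t *\<^sub>C ?Q (\<mu> + u x t)))"
        unfolding split_beta
        by (intro continuous_intros scaleC.continuous_on
            bounded_bilinear.continuous_on[OF bounded_bilinear_blinfun_compose]
            continuous_on_compose2[OF continuous_on_resolvent])
          (use circle_resolvent_set in auto)
    qed auto
    moreover have "((\<lambda>t. - (unit_circle t *\<^sub>C ?Q (\<mu> + u q t))) has_integral 0) {0..1}"
    proof -
      \<comment> \<open>The angular derivative of \<open>R(\<mu> + u)\<close> is
        \<open>2 \<pi> i q\<close> times the radial one, and its integral vanishes because both
        endpoints are the same point.\<close>
      have "((\<lambda>t. - ((of_real q * (2 * of_real pi * \<i> * unit_circle t)) *\<^sub>C ?Q (\<mu> + u q t)))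
          has_integral R (\<mu> + u q 1) - R (\<mu> + u q 0)) {0..1}"
        by (rule fundamental_theorem_of_calculus, simp, rule chain)
          (use q circle_resolvent_set in \<open>auto intro!: derivative_eq_intros has_vector_derivative_unit_circle
            has_vector_derivative_mult_right\<close>)
      from has_integral_linear[OF this bounded_linear_scaleC[of "1 / (of_real q * (2 * of_real pi * \<i>))"]]
      show ?thesis
        using q by (simp add: o_def scaleC.minus_right scaleC_scaleC)
    qed
    ultimately show ?thesis
      by (simp only: integral_unique cbox_interval resolvent_moment_def[abs_def] power_0 scaleC.scale_one)
  qed
  obtain c where "\<And>q. q \<in> {0<..r} \<Longrightarrow> moment 0 q = c"
    by (rule has_vector_derivative_zero_constant[OF _ deriv]) auto
  then show ?thesis using s r_pos by simp
qed

lemma moment_1_const: "0 < s \<Longrightarrow> s \<le> r \<Longrightarrow> moment 1 s = moment 1 r"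
  by (rule blinfun_eqI) (simp add: moment_1 moment_0_const[of s] r_pos del: One_nat_def)

lemma moment_2_const: "0 < s \<Longrightarrow> s \<le> r \<Longrightarrow> moment 2 s = moment 2 r"
  by (rule blinfun_eqI) (simp add: moment_2 moment_1_const[of s] r_pos del: One_nat_def)

lemma moment_1_nonzero: "moment 1 r \<noteq> 0"
proof
  assume 0: "moment 1 r = 0"
  have r: "0 < r" "r \<le> r" using r_pos by auto
  have "\<mu> *\<^sub>C moment 0 r x - T (moment 0 r x) = x" for x
    using moment_1[OF r, of x] 0 by (simp add: algebra_simps)
  \<comment> \<open>Commutation with \<open>T\<close> turns the right inverse into a left
    inverse.\<close>
  moreover have "moment 0 r (\<mu> *\<^sub>C x - T x) = \<mu> *\<^sub>C moment 0 r x - T (moment 0 r x)" for x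
    by (simp add: blinfun.diff_right moment_commute[OF r] complex_linearD[OF complex_linear_moment[OF r]])
  ultimately have "is_inverse_op (\<mu> *\<^sub>C id_blinfun - T) (moment 0 r)"
    using complex_linear_moment[OF r] by (simp add: is_inverse_op_iff blinfun.diff_left)
  moreover have "\<mu> \<in> op_spectrum T" using isolated by auto
  ultimately show False by (auto simp: op_spectrum_def invertible_op_def)
qed

text \<open>The trivial estimate on the circle of radius \<open>s\<close> transfers to radius
  \<open>r\<close> by independence of the radius.\<close>

lemma norm_moment_1_le:
  assumes s: "0 < s" "s \<le> r" and K: "\<And>t. norm (R (\<mu> + u s t)) \<le> K"
  shows "norm (moment 1 r) \<le> s * K"
proof -
  have "norm (moment 1 s) \<le> s * K * (1 - 0)"
    unfolding resolvent_moment_def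
  proof (rule integral_bound[OF zero_le_one continuous_on_integrand[OF s]])
    show "norm (u s t ^ 1 *\<^sub>C R (\<mu> + u s t)) \<le> s * K" for t
      using K[of t] s by (simp add: norm_scaleC norm_mult)
  qed
  then show ?thesis using moment_1_const[OF s] by simp
qed

end

section \<open>Shrinking circles and the growth bound\<close>

lemma eq_0_if_norm_le_small:
  fixes x :: "'b::real_normed_vector"
  assumes "0 < d" and "\<And>s. 0 < s \<Longrightarrow> s \<le> d \<Longrightarrow> norm x \<le> s * C"
  shows "x = 0"
proof -
  have "norm x \<le> 0"
  proof (rule tendsto_lowerbound)
    show "((\<lambda>s. s * C) \<longlongrightarrow> 0) (at_right 0)"
      by (auto intro!: tendsto_eq_intros)
    show "\<forall>\<^sub>F s in at_right 0. norm x \<le> s * C"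
      using eventually_at_right_less[of 0] eventually_at_rightI[of 0 d "\<lambda>s. s \<le> d"] assms
      by (auto elim!: eventually_elim2)
  qed simp
  then show ?thesis by simp
qed

text \<open>Power-boundedness enters through this bound alone; \<open>C\<close> becomes
  \<open>M + M * M\<close> when the locale is instantiated.\<close>

locale isolated_power_bounded = isolated_spectral_point +
  fixes C :: real
  assumes growth: "w \<notin> op_spectrum T \<Longrightarrow> \<bar>cmod w - 1\<bar> * norm (op_resolvent T w) \<le> C"
begin

text \<open>Otherwise the resolvent stays bounded near \<open>\<mu>\<close>, and the Riesz projection vanishes.\<close>

lemma norm_isolated_point: "cmod \<mu> = 1"
proof (rule ccontr)
  define \<delta> where "\<delta> = \<bar>cmod \<mu> - 1\<bar>"
  assume "cmod \<mu> \<noteq> 1"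
  then have \<delta>: "\<delta> > 0" by (simp add: \<delta>_def)
  have "moment 1 r = 0"
  proof (rule eq_0_if_norm_le_small)
    \<comment> \<open>Radii up to \<open>\<delta> / 2\<close> keep \<open>\<bar>w\<bar>\<close> at
      distance at least \<open>\<delta> / 2\<close> from 1.\<close>
    show "0 < min r (\<delta> / 2)" using r_pos \<delta> by simp
    fix s assume "0 < s" "s \<le> min r (\<delta> / 2)"
    then have s: "0 < s" "s \<le> r" "s \<le> \<delta> / 2" by auto
    show "norm (moment 1 r) \<le> s * (2 * C / \<delta>)"
    proof (rule norm_moment_1_le[OF s(1,2)])
      fix t
      have "cmod (u s t) = s" using s by (simp add: norm_mult)
      then have "\<bar>cmod (\<mu> + u s t) - cmod \<mu>\<bar> \<le> s"
        using norm_triangle_ineq3[of "\<mu> + u s t" \<mu>] by simp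
      then have "\<bar>cmod (\<mu> + u s t) - 1\<bar> \<ge> \<delta> / 2"
        using s(3) by (simp add: \<delta>_def abs_if field_simps split: if_splits)
      then have "\<delta> / 2 * norm (R (\<mu> + u s t)) \<le> C"
        using growth[OF circle_resolvent_set[OF s(1,2)], of t]
        by (meson mult_right_mono norm_ge_zero order_trans)
      then show "norm (R (\<mu> + u s t)) \<le> 2 * C / \<delta>"
        using \<delta> by (simp add: field_simps)
    qed
  qed
  then show False using moment_1_nonzero by simp
qed

text \<open>The combination \<open>B\<close> of the three moments is \<open>O(s)\<close>, and two of
  its terms carry a factor \<open>s^2\<close>. As no moment depends on the radius, the remaining one
  is bounded by a constant times \<open>s\<close>.\<close>

lemma moment_2_eq_0: "moment 2 r = 0"
proof (rule eq_0_if_norm_le_small)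
  \<comment> \<open>The bound \<open>s \<le> 1\<close> yields both
    \<open>\<bar>w\<bar> + 1 \<le> 3\<close> and \<open>s^2 \<le> s\<close>.\<close>
  show "0 < min r 1" using r_pos by simp
  fix s assume "0 < s" "s \<le> min r 1"
  then have s: "0 < s" "s \<le> r" and s1: "s \<le> 1" by auto
  have C0: "0 \<le> C"
    using order_trans[OF _ growth[OF circle_resolvent_set[OF s]]] by simp
  let ?c = "complex_of_real (s\<^sup>2)"
  let ?p = "\<lambda>t. (u s t)\<^sup>2 + ?c * \<mu> * u s t + ?c * \<mu>\<^sup>2"
  define B where "B = moment 2 s + (?c * \<mu>) *\<^sub>C moment 1 s + (?c * \<mu>\<^sup>2) *\<^sub>C moment 0 s"
  have "((\<lambda>t. u s t ^ 2 *\<^sub>C R (\<mu> + u s t) + (?c * \<mu>) *\<^sub>C (u s t ^ 1 *\<^sub>C R (\<mu> + u s t))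
      + (?c * \<mu>\<^sup>2) *\<^sub>C (u s t ^ 0 *\<^sub>C R (\<mu> + u s t))) has_integral B) {0..1}"
    unfolding B_def
    by (intro has_integral_add has_integral_moment[OF s]
        has_integral_linear[OF has_integral_moment[OF s] bounded_linear_scaleC, unfolded o_def])
  then have int: "((\<lambda>t. ?p t *\<^sub>C R (\<mu> + u s t)) has_integral B) {0..1}"
    by (simp add: scaleC_add_left scaleC_scaleC mult.assoc)
  have "norm B \<le> s * (3 * C) * measure lborel {0..1::real}"
  proof (rule has_integral_bound_real[OF _ finite.emptyI int])
    fix t
    define w where "w = \<mu> + u s t"
    have us: "cmod (u s t) = s" using s by (simp add: norm_mult)
    have w: "cmod w + 1 \<le> 3"
      using norm_triangle_ineq[of \<mu> "u s t"] us norm_isolated_point s1 by (simp add: w_def)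
    have "norm (?p t *\<^sub>C R w) = s * (cmod w + 1) * (\<bar>cmod w - 1\<bar> * norm (R w))"
      unfolding norm_scaleC norm_quadratic_circle[OF norm_isolated_point us] w_def by simp
    also have "\<dots> \<le> s * (cmod w + 1) * C"
      using growth[OF circle_resolvent_set[OF s], of t] s
      by (intro mult_left_mono) (auto simp: w_def add_nonneg_nonneg)
    also have "\<dots> \<le> s * 3 * C"
      using w s C0 by (intro mult_right_mono mult_left_mono) auto
    finally show "norm (?p t *\<^sub>C R (\<mu> + u s t)) \<le> s * (3 * C)"
      by (simp add: w_def mult.assoc)
  qed (use s C0 in auto)
  then have B: "norm B \<le> s * (3 * C)" by simp
  have s2: "s\<^sup>2 \<le> s" using s s1 by (simp add: power2_eq_square mult_left_le)
  have split: "moment 2 r = B - (?c * \<mu>) *\<^sub>C moment 1 r - (?c * \<mu>\<^sup>2) *\<^sub>C moment 0 r"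
    unfolding B_def using moment_0_const[OF s] moment_1_const[OF s] moment_2_const[OF s] by simp
  have "norm (moment 2 r) \<le> norm B + norm ((?c * \<mu>) *\<^sub>C moment 1 r)
      + norm ((?c * \<mu>\<^sup>2) *\<^sub>C moment 0 r)"
    unfolding split
    using norm_triangle_ineq4[of "B - (?c * \<mu>) *\<^sub>C moment 1 r" "(?c * \<mu>\<^sup>2) *\<^sub>C moment 0 r"]
      norm_triangle_ineq4[of B "(?c * \<mu>) *\<^sub>C moment 1 r"] by linarith
  also have "\<dots> = norm B + s\<^sup>2 * norm (moment 1 r) + s\<^sup>2 * norm (moment 0 r)"
    by (simp only: norm_scaleC norm_mult norm_power norm_of_real norm_isolated_point) simp
  also have "\<dots> \<le> s * (3 * C) + s * norm (moment 1 r) + s * norm (moment 0 r)"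
    using B s2 by (intro add_mono mult_right_mono) auto
  finally show "norm (moment 2 r) \<le> s * (3 * C + norm (moment 1 r) + norm (moment 0 r))"
    by (simp add: algebra_simps)
qed

end

section \<open>The spectral decomposition at the isolated point\<close>

theorem theorem3p2:
  fixes T P :: "'a::complex_banach \<Rightarrow>\<^sub>L 'a" and \<mu> :: complex
  assumes "complex_linear T"
    and "invertible_op T"
    and "bdd_above (range (\<lambda>n::int. norm (powi_op T n)))"
    and "\<mu> isolated_in op_spectrum T"
    and "is_riesz_projection_at T \<mu> P"
  shows "op_eigenvalue T \<mu>
    \<and> op_eigenspace T \<mu> = range (blinfun_apply P)
    \<and> invariant_subspace T (op_kernel P)
    \<and> direct_sum_decomp (range (blinfun_apply P)) (op_kernel P)"
proof -
  obtain M where M: "norm (powi_op T n) \<le> M" for n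
    using assms(3) by (auto simp: bdd_above_def)
  have pos: "norm (power_op T n) \<le> M" for n
    using M[of "int n"] by (simp add: powi_op_def)
  \<comment> \<open>\<open>powi_op\<close> uses powers of the inverse only for negative exponents,
    so \<open>n = 0\<close> is treated through \<open>M[of 0]\<close>.\<close>
  have neg: "norm (power_op (inverse_op T) n) \<le> M" for n
    using M[of "- int n"] M[of 0] by (cases "n = 0") (simp_all add: powi_op_def)
  obtain r where r: "r > 0" "cball \<mu> r \<inter> op_spectrum T = {\<mu>}"
    and P0: "P = riesz_integral T (circlepath \<mu> r)"
    using assms(5) by (auto simp: is_riesz_projection_at_def)
  interpret isolated_power_bounded T \<mu> r "M + M * M"
    by unfold_locales
      (use assms(1) r resolvent_growth[OF assms(1) is_inverse_op_inverse_op[OF assms(2)] pos neg] in auto)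
  note P = P0[unfolded riesz_integral_circlepath]
  have P_lin: "complex_linear P"
    using complex_linear_moment[of r 1] r by (simp add: P)
  \<comment> \<open>The vanishing second moment is \<open>(T - \<mu>) P\<close>.\<close>
  have eigen: "T (P x) = \<mu> *\<^sub>C P x" for x
    using moment_2[of r x] moment_2_eq_0 r by (simp add: P)
  have fixed: "P x = x" if "T x = \<mu> *\<^sub>C x" for x
    using moment_fixed[of r x] that r by (simp add: P)
  have commute: "P (T x) = T (P x)" for x
    using moment_commute[of r 1 x] r by (simp add: P)
  obtain x where "P x \<noteq> 0"
    using moment_1_nonzero blinfun_eqI[of P 0] by (auto simp: P)
  then have "op_eigenvalue T \<mu>"
    using eigen by (auto simp: op_eigenvalue_def)
  moreover have "op_eigenspace T \<mu> = range (blinfun_apply P)"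
    using eigen fixed by (auto simp: op_eigenspace_def) (metis rangeI)
  moreover have "invariant_subspace T (op_kernel P)"
    using complex_subspace_kernel[OF P_lin] commute
    by (auto simp: invariant_subspace_def op_kernel_def blinfun.zero_right)
  moreover have "direct_sum_decomp (range (blinfun_apply P)) (op_kernel P)"
    \<comment> \<open>Idempotence: \<open>P x\<close> satisfies the eigenvector equation, and
      \<open>P\<close> fixes every such vector.\<close>
    by (rule direct_sum_decomp_projection[OF P_lin fixed[OF eigen]])
  ultimately show ?thesis by blast
qed

end
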